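(* The Ranking algorithm is $0.5541$-competitive for the Fully Online Bipartite Matching problem: for every instance whose underlying graph is bipartite, the expected size of the matching produced by Ranking is at least $0.5541$ times the size of a maximum matching of the graph.
   Context: Fully Online (Bipartite) Matching: an undirected (here bipartite) graph $G=(V,E)$ is initially unknown. Time proceeds in steps, each being either the arrival of a vertex $v$ (edges between $v$ and previously-arrived vertices are revealed) or the deadline of a vertex $v$. Each vertex's deadline occurs after its own arrival and after the arrivals of all its neighbours. At the deadline of $v$, if $v$ is not already matched, the algorithm must irrevocably either match $v$ to a currently unmatched neighbour or leave it unmatched. The instance is fixed in advance by an oblivious adversary. An algorithm is $F$-competitive if on every instance its expected matching size is at least $F$ times the maximum matching size. Ranking: when $v$ arrives, draw $y_v$ uniformly from $[0,1)$ independently; at the deadline of an unmatched $v$, match it to its unmatched neighbour of smallest rank if one exists, otherwise leave it unmatched. *)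

theory Defs
  imports "HOL-Probability.Probability" "HOL-Library.Disjoint_Sets"
begin

text \<open>
  An undirected simple graph is given by its vertex set \<open>V\<close> and its set \<open>E\<close> of
  two-element subsets of \<open>V\<close>.
\<close>

definition simple_graph :: "'v set \<Rightarrow> 'v set set \<Rightarrow> bool" where
  "simple_graph V E \<longleftrightarrow> finite V \<and> (\<forall>e\<in>E. e \<subseteq> V \<and> card e = 2)"

definition bipartite :: "'v set \<Rightarrow> 'v set set \<Rightarrow> bool" where
  "bipartite V E \<longleftrightarrow>
     (\<exists>A B. A \<union> B = V \<and> A \<inter> B = {} \<and> (\<forall>e\<in>E. \<exists>a\<in>A. \<exists>b\<in>B. e = {a, b}))"

definition is_matching :: "'v set set \<Rightarrow> 'v set set \<Rightarrow> bool" where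
  "is_matching E M \<longleftrightarrow> M \<subseteq> E \<and> disjoint M"

definition max_matching_size :: "'v set set \<Rightarrow> nat" where
  "max_matching_size E = Max {card M |M. is_matching E M}"

datatype 'v event = Arrival 'v | Deadline 'v

definition precedes :: "'a list \<Rightarrow> 'a \<Rightarrow> 'a \<Rightarrow> bool" where
  "precedes xs a b \<longleftrightarrow> (\<exists>i j. i < j \<and> j < length xs \<and> xs ! i = a \<and> xs ! j = b)"

definition fully_online_instance :: "'v set \<Rightarrow> 'v set set \<Rightarrow> 'v event list \<Rightarrow> bool" where
  "fully_online_instance V E evs \<longleftrightarrow>
     simple_graph V E \<and>
     distinct evs \<and> set evs = Arrival ` V \<union> Deadline ` V \<and>
     (\<forall>v\<in>V. precedes evs (Arrival v) (Deadline v)) \<and>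
     (\<forall>u\<in>V. \<forall>v\<in>V. {u, v} \<in> E \<longrightarrow> precedes evs (Arrival u) (Deadline v))"

text \<open>
  The state of Ranking is the set of edges matched so far; a vertex \<open>u\<close> is matched iff
  \<open>u \<in> \<Union>M\<close>. The step at the deadline of \<open>v\<close> inspects only edges at \<open>v\<close>, all of which have been
  revealed by then in a valid instance. An unmatched neighbour \<open>u\<close> of an unmatched \<open>v\<close> cannot
  have passed its own deadline, as \<open>u\<close> would have been matched there (\<open>v\<close> being available).
  Equal ranks occur with probability 0, so the tie-breaking of \<^const>\<open>arg_min_on\<close> is immaterial.
\<close>

fun ranking_step ::
  "'v set set \<Rightarrow> ('v \<Rightarrow> real) \<Rightarrow> 'v event \<Rightarrow> 'v set set \<Rightarrow> 'v set set" where
  "ranking_step E y (Arrival v) M = M"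
| "ranking_step E y (Deadline v) M =
     (let N = {u. {v, u} \<in> E \<and> u \<notin> \<Union>M}
      in if v \<in> \<Union>M \<or> N = {} then M else insert {v, arg_min_on y N} M)"

definition ranking :: "'v set set \<Rightarrow> 'v event list \<Rightarrow> ('v \<Rightarrow> real) \<Rightarrow> 'v set set" where
  "ranking E evs y = fold (ranking_step E y) evs {}"

text \<open>
  The instance does not depend on the ranks (the adversary is oblivious), so drawing \<open>y v\<close>
  independently at each arrival amounts to drawing all ranks from the product distribution.
\<close>

definition rank_measure :: "'v set \<Rightarrow> ('v \<Rightarrow> real) measure" where
  "rank_measure V = Pi\<^sub>M V (\<lambda>_. uniform_measure lborel {0..<1})"

definition expected_ranking_size :: "'v set \<Rightarrow> 'v set set \<Rightarrow> 'v event list \<Rightarrow> real" where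
  "expected_ranking_size V E evs = (\<integral>y. real (card (ranking E evs y)) \<partial>rank_measure V)"

end

theory Submission
  imports Defs
begin

text \<open>
  Split the value 1 of a matched edge between its endpoints: the passive endpoint, of rank \<open>r\<close>, gets
  \<open>g r = 0.39 + 0.48 r\<close> (a numerically good choice of an increasing split), the active one gets
  \<open>1 - g r\<close>. It suffices that the endpoints of every edge
  \<open>{u, v}\<close> together expect at least \<open>0.5541\<close>. Let the deadline of \<open>u\<close> come first, fix all
  ranks except that of \<open>v\<close>, and look at the run on the graph without \<open>v\<close> just before the deadline
  of \<open>u\<close>. If \<open>u\<close> is matched there, it is so in the full graph, whence \<open>g (y u)\<close>. Otherwise let \<open>s\<close>
  be the least rank of a free neighbour of \<open>u\<close>. For \<open>y v < s\<close> the two endpoints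
  get at least \<open>g (y v) + min (g (y u)) (1 - g s)\<close>, and for \<open>y v > s\<close> at least \<open>1 - g s\<close>;
  if there is no free neighbour they get at least \<open>g (y v)\<close>. Averaging over
  \<open>y v\<close> gives at least \<open>min (g (y u)) 0.601\<close> in every case, and the mean of this over \<open>y u\<close> exceeds
  \<open>0.5541\<close>.
\<close>

section \<open>Ranking with oriented edges\<close>

definition free_nbrs :: "'v set set \<Rightarrow> ('v \<times> 'v) set \<Rightarrow> 'v \<Rightarrow> 'v set" where
  "free_nbrs E P v = {u. {v, u} \<in> E \<and> u \<notin> Field P}"

text \<open>
  In a pair of a run the first component is the active endpoint: the match was made at its deadline.
\<close>

fun run_step ::
  "'v set set \<Rightarrow> ('v \<Rightarrow> real) \<Rightarrow> 'v event \<Rightarrow> ('v \<times> 'v) set \<Rightarrow> ('v \<times> 'v) set" where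
  "run_step E y (Arrival v) P = P"
| "run_step E y (Deadline v) P =
     (if v \<in> Field P \<or> free_nbrs E P v = {} then P
      else insert (v, arg_min_on y (free_nbrs E P v)) P)"

definition run :: "'v set set \<Rightarrow> ('v \<Rightarrow> real) \<Rightarrow> 'v event list \<Rightarrow> ('v \<times> 'v) set" where
  "run E y evs = fold (run_step E y) evs {}"

definition edges_of :: "('v \<times> 'v) set \<Rightarrow> 'v set set" where
  "edges_of P = (\<lambda>(a, b). {a, b}) ` P"

text \<open>Deletion removes only the edges at \<open>v\<close>: the vertex set and the events stay
  the same, and the deadline of \<open>v\<close> becomes an idle step. Both runs can then be
  compared event by event.\<close>

definition without :: "'v set set \<Rightarrow> 'v \<Rightarrow> 'v set set" where
  "without E v = {e \<in> E. v \<notin> e}"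

section \<open>Growth of runs and agreement with Ranking\<close>

lemma run_Nil [simp]: "run E y [] = {}"
  by (simp add: run_def)

lemma run_snoc: "run E y (evs @ [e]) = run_step E y e (run E y evs)"
  by (simp add: run_def)

lemma run_append: "run E y (evs @ evs') = fold (run_step E y) evs' (run E y evs)"
  by (simp add: run_def)

lemma run_step_mono: "P \<subseteq> run_step E y e P"
  by (cases e) auto

lemma fold_run_step_mono: "P \<subseteq> fold (run_step E y) evs P"
proof (induction evs arbitrary: P)
  case (Cons e evs)
  show ?case using run_step_mono[of P E y e] Cons.IH[of "run_step E y e P"] by auto
qed simp

lemma run_prefix_mono: "run E y evs \<subseteq> run E y (evs @ evs')"
  unfolding run_append by (rule fold_run_step_mono)

lemma Union_edges_of: "\<Union>(edges_of P) = Field P"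
  by (force simp: edges_of_def Field_def)

text \<open>Forgetting orientations commutes with every step, because the union of the edges is the
  field of the relation and so both versions see the same free vertices.\<close>

lemma ranking_eq_edges_of_run: "ranking E evs y = edges_of (run E y evs)"
proof -
  have "ranking_step E y e (edges_of P) = edges_of (run_step E y e P)" for e P
    by (cases e) (auto simp: Let_def free_nbrs_def Union_edges_of, auto simp: edges_of_def)
  then have "fold (ranking_step E y) evs (edges_of P) = edges_of (fold (run_step E y) evs P)" for P
    by (induction evs arbitrary: P) auto
  from this[of "{}"] show ?thesis by (simp add: ranking_def run_def edges_of_def)
qed

section \<open>Dependence of a run on the order of the ranks\<close>

lemma arg_min_on_cong:
  fixes y y' :: "'v \<Rightarrow> real"
  assumes "\<And>a b. a \<in> N \<Longrightarrow> b \<in> N \<Longrightarrow> y a < y b \<longleftrightarrow> y' a < y' b"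
  shows "arg_min_on y N = arg_min_on y' N"
proof -
  have "is_arg_min y (\<lambda>x. x \<in> N) = is_arg_min y' (\<lambda>x. x \<in> N)"
    using assms by (auto simp: is_arg_min_def fun_eq_iff)
  then show ?thesis by (simp add: arg_min_on_def arg_min_def)
qed

text \<open>Only comparisons of ranks at vertices covered by \<open>E\<close> enter a run. This
  serves twice: the run without \<open>v\<close> ignores the rank of \<open>v\<close>, and a run
  takes only finitely many values as the ranks vary.\<close>

lemma run_cong:
  assumes "\<And>a b. a \<in> \<Union>E \<Longrightarrow> b \<in> \<Union>E \<Longrightarrow> y a < y b \<longleftrightarrow> y' a < y' b"
  shows "run E y evs = run E y' evs"
proof -
  have "run_step E y e P = run_step E y' e P" for e P
  proof (cases e)
    case (Deadline v)
    have "free_nbrs E P v \<subseteq> \<Union>E" by (auto simp: free_nbrs_def)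
    then have "arg_min_on y (free_nbrs E P v) = arg_min_on y' (free_nbrs E P v)"
      using assms by (intro arg_min_on_cong) blast
    with Deadline show ?thesis by simp
  qed simp
  then have "run_step E y = run_step E y'" by (intro ext)
  then show ?thesis by (simp add: run_def)
qed

lemma arg_min_on_mem:
  fixes y :: "'v \<Rightarrow> real"
  assumes "finite N" "N \<noteq> {}"
  shows "arg_min_on y N \<in> N"
  using arg_min_if_finite(1)[OF assms] .

lemma arg_min_on_eqI:
  fixes y :: "'v \<Rightarrow> real"
  assumes "finite N" "a \<in> N" "\<And>b. b \<in> N \<Longrightarrow> y a \<le> y b" "inj_on y N"
  shows "arg_min_on y N = a"
proof -
  have "arg_min_on y N \<in> N" using assms by (intro arg_min_on_mem) auto
  moreover have "y (arg_min_on y N) \<le> y a" using assms by (intro arg_min_least) auto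
  ultimately show ?thesis using assms by (metis inj_onD order_antisym)
qed

section \<open>Runs on a finite simple graph\<close>

locale graph =
  fixes V :: "'v set" and E :: "'v set set"
  assumes simple_graph: "simple_graph V E"
begin

lemma finite_V: "finite V"
  using simple_graph by (simp add: simple_graph_def)

lemma E_sub: "e \<in> E \<Longrightarrow> e \<subseteq> V \<and> card e = 2"
  using simple_graph by (simp add: simple_graph_def)

lemma edge_in_V: "{a, b} \<in> E \<Longrightarrow> a \<in> V \<and> b \<in> V \<and> a \<noteq> b"
  using E_sub[of "{a, b}"] by (auto simp: card_insert_if split: if_splits)

lemma free_nbrs_sub: "free_nbrs E P q \<subseteq> V"
  using edge_in_V by (auto simp: free_nbrs_def)

lemma finite_free_nbrs: "finite (free_nbrs E P q)"
  using free_nbrs_sub finite_V by (rule finite_subset)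

lemma choice_mem:
  fixes y :: "'v \<Rightarrow> real"
  shows "free_nbrs E P q \<noteq> {} \<Longrightarrow> arg_min_on y (free_nbrs E P q) \<in> free_nbrs E P q"
  by (intro arg_min_on_mem finite_free_nbrs)

lemma choice_le:
  fixes y :: "'v \<Rightarrow> real"
  shows "b \<in> free_nbrs E P q \<Longrightarrow> y (arg_min_on y (free_nbrs E P q)) \<le> y b"
  using arg_min_least[OF finite_free_nbrs] by blast

lemma run_sub: "run E y evs \<subseteq> V \<times> V"
proof (induction evs rule: rev_induct)
  case (snoc e evs)
  show ?case
  proof (cases e)
    case (Deadline q)
    let ?N = "free_nbrs E (run E y evs) q"
    have "?N \<noteq> {} \<Longrightarrow> q \<in> V" using edge_in_V by (auto simp: free_nbrs_def)
    with Deadline snoc choice_mem[of "run E y evs" q] free_nbrs_sub[of "run E y evs" q] show ?thesis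
      by (auto simp: run_snoc)
  qed (use snoc in \<open>simp add: run_snoc\<close>)
qed simp

lemma finite_run: "finite (run E y evs)"
  using run_sub finite_V by (meson finite_SigmaI finite_subset)

text \<open>No edge is produced twice: each new pair contains the vertex whose deadline it is, which
  lay outside the field so far.\<close>

lemma card_edges_of_run: "card (edges_of (run E y evs)) = card (run E y evs)"
proof (induction evs rule: rev_induct)
  case (snoc e evs)
  let ?P = "run E y evs"
  show ?case
  proof (cases e)
    case (Deadline q)
    show ?thesis
    proof (cases "q \<in> Field ?P \<or> free_nbrs E ?P q = {}")
      case False
      define z where "z = arg_min_on y (free_nbrs E ?P q)"
      have "{q, z} \<notin> edges_of ?P"
        using False Union_edges_of[of ?P] by blast
      moreover have "(q, z) \<notin> ?P" using False by (auto simp: Field_def)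
      moreover have "edges_of (insert (q, z) ?P) = insert {q, z} (edges_of ?P)"
        by (simp add: edges_of_def)
      moreover have "finite (edges_of ?P)" by (simp add: edges_of_def finite_run)
      ultimately show ?thesis
        using False Deadline snoc finite_run[of y evs] by (simp add: run_snoc z_def)
    qed (use Deadline snoc in \<open>simp add: run_snoc\<close>)
  qed (use snoc in \<open>simp add: run_snoc\<close>)
qed (simp add: edges_of_def)

lemma active_deadline: "(a, b) \<in> run E y evs \<Longrightarrow> Deadline a \<in> set evs"
proof (induction evs rule: rev_induct)
  case (snoc e evs)
  then show ?case by (cases e) (auto simp: run_snoc split: if_splits)
qed simp

end

section \<open>Comparing runs with and without a vertex\<close>

locale ranked_graph = graph +
  fixes y :: "'a \<Rightarrow> real"
  assumes inj_y: "inj_on y V"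
begin

lemma inj_on_free_nbrs: "inj_on y (free_nbrs E P q)"
  using inj_y free_nbrs_sub by (rule inj_on_subset)

lemma choice_eqI:
  "a \<in> free_nbrs E P q \<Longrightarrow> (\<And>b. b \<in> free_nbrs E P q \<Longrightarrow> y a \<le> y b)
    \<Longrightarrow> arg_min_on y (free_nbrs E P q) = a"
  by (intro arg_min_on_eqI finite_free_nbrs inj_on_free_nbrs)

lemma without_ranked_graph: "ranked_graph V (without E v) y"
  using simple_graph inj_y by unfold_locales (auto simp: without_def simple_graph_def)

text \<open>Adding \<open>v\<close> outside \<open>L\<close> makes competition harder for its own
  side and easier for \<open>L\<close>. The two inclusions sustain each other as a joint invariant:
  at each deadline they order the two candidate sets by inclusion, apart from \<open>v\<close>
  itself. Injectivity of the ranks makes equal minima equal vertices.\<close>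

lemma run_without_mono:
  assumes bip: "\<And>a b. {a, b} \<in> E \<Longrightarrow> a \<in> L \<longleftrightarrow> b \<notin> L" and v: "v \<notin> L"
  shows "Field (run (without E v) y evs) \<inter> L \<subseteq> Field (run E y evs) \<and>
    Field (run E y evs) - L \<subseteq> insert v (Field (run (without E v) y evs))"
proof -
  interpret W: ranked_graph V "without E v" y by (rule without_ranked_graph)
  show ?thesis
  proof (induction evs rule: rev_induct)
    case (snoc e evs)
    define P0 where "P0 = run (without E v) y evs"
    define P1 where "P1 = run E y evs"
    have IH: "Field P0 \<inter> L \<subseteq> Field P1" "Field P1 - L \<subseteq> insert v (Field P0)"
      using snoc by (auto simp: P0_def P1_def)
    show ?case
    proof (cases e)
      case (Deadline q)
      define N0 where "N0 = free_nbrs (without E v) P0 q"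
      define N1 where "N1 = free_nbrs E P1 q"
      define z0 where "z0 = arg_min_on y N0"
      define z1 where "z1 = arg_min_on y N1"
      have z0: "z0 \<in> N0" "\<And>b. b \<in> N0 \<Longrightarrow> y z0 \<le> y b" if "N0 \<noteq> {}"
        using that W.choice_mem W.choice_le by (auto simp: N0_def z0_def)
      have z1: "z1 \<in> N1" "\<And>b. b \<in> N1 \<Longrightarrow> y z1 \<le> y b" if "N1 \<noteq> {}"
        using that choice_mem choice_le by (auto simp: N1_def z1_def)
      have r0: "run (without E v) y (evs @ [e]) =
          (if q \<in> Field P0 \<or> N0 = {} then P0 else insert (q, z0) P0)"
        by (simp add: run_snoc Deadline P0_def N0_def z0_def)
      have r1: "run E y (evs @ [e]) = (if q \<in> Field P1 \<or> N1 = {} then P1 else insert (q, z1) P1)"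
        by (simp add: run_snoc Deadline P1_def N1_def z1_def)
      have N0_iff: "z \<in> N0 \<longleftrightarrow> {q, z} \<in> E \<and> z \<notin> Field P0 \<and> z \<noteq> v \<and> q \<noteq> v" for z
        by (auto simp: N0_def free_nbrs_def without_def)
      have N1_iff: "z \<in> N1 \<longleftrightarrow> {q, z} \<in> E \<and> z \<notin> Field P1" for z
        by (auto simp: N1_def free_nbrs_def)
      have NV: "N0 \<subseteq> V" "N1 \<subseteq> V" by (auto simp: N0_def N1_def W.free_nbrs_sub free_nbrs_sub)
      have antisym: "a = b" if "y a \<le> y b" "y b \<le> y a" "a \<in> V" "b \<in> V" for a b
        using that inj_y by (meson inj_onD order_antisym)
      show ?thesis
      proof (cases "q \<in> L")
        case True
        \<comment> \<open>Here the candidates lie outside \<open>L\<close>, where the full run has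
          matched no more than the reduced one, except possibly \<open>v\<close>. A choice of the
          full run that is not a candidate of the reduced run is therefore \<open>v\<close> or
          already matched there; any other choice is also the minimum of the smaller set
          \<open>N0\<close>.\<close>
        have sub: "N0 \<subseteq> N1" using IH True bip by (force simp: N0_iff N1_iff)
        have stay: "z \<in> N0" if "z \<in> N1" "z \<notin> Field P0" "z \<noteq> v" for z
          using that True v by (auto simp: N0_iff N1_iff)
        have out: "z \<notin> L" if "z \<in> N1" for z using that True bip by (auto simp: N1_iff)
        have eq: "z1 = z0" if z1N0: "z1 \<in> N0"
        proof (rule antisym)
          have "N0 \<noteq> {}" "N1 \<noteq> {}" using z1N0 sub by auto
          then show "y z1 \<le> y z0" "y z0 \<le> y z1" "z1 \<in> V" "z0 \<in> V"
            using z0 z1 sub z1N0 NV by auto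
        qed
        have "N1 \<noteq> {} \<longrightarrow> z1 \<notin> L \<and> (z1 \<in> Field P0 \<or> z1 = v \<or> N0 \<noteq> {} \<and> z1 = z0)"
          using z1(1) out[of z1] stay[of z1] eq by blast
        moreover have "N0 \<noteq> {} \<longrightarrow> N1 \<noteq> {} \<and> z0 \<notin> L"
          using sub z0(1) out[of z0] by blast
        ultimately show ?thesis
          unfolding r0 r1 using IH True by auto
      next
        case False
        \<comment> \<open>Now the candidates lie in \<open>L\<close>, so the inclusion is reversed.
          The deadline of \<open>v\<close> is separate: it is idle in the reduced run, while in the
          full run it can only add \<open>v\<close> and a vertex of \<open>L\<close>.\<close>
        have sub: "N1 \<subseteq> N0" if "q \<noteq> v" using IH False bip that v by (force simp: N0_iff N1_iff)
        have inL: "z \<in> L" if "z \<in> N1 \<or> z \<in> N0" for z using that False bip by (auto simp: N0_iff N1_iff)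
        show ?thesis
        proof (cases "q = v")
          case True
          then have "N0 = {}" by (auto simp: N0_iff)
          with True IH inL z1 show ?thesis unfolding r0 r1 by (auto simp: Field_insert)
        next
          case neq: False
          have stay: "z \<in> N1" if "z \<in> N0" "z \<notin> Field P1" for z
            using that by (auto simp: N0_iff N1_iff)
          have eq: "z1 = z0" if z0N1: "z0 \<in> N1"
          proof (rule antisym)
            have "N0 \<noteq> {}" "N1 \<noteq> {}" using z0N1 sub[OF neq] by auto
            then show "y z1 \<le> y z0" "y z0 \<le> y z1" "z1 \<in> V" "z0 \<in> V"
              using z0 z1 sub[OF neq] z0N1 NV by auto
          qed
          have "N0 \<noteq> {} \<longrightarrow> z0 \<in> L \<and> (z0 \<in> Field P1 \<or> N1 \<noteq> {} \<and> z1 = z0)"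
            using z0(1) inL[of z0] stay[of z0] eq by blast
          moreover have "N1 \<noteq> {} \<longrightarrow> N0 \<noteq> {} \<and> z1 \<in> L"
            using sub[OF neq] z1(1) inL[of z1] by blast
          ultimately show ?thesis
            unfolding r0 r1 using IH False neq by auto
        qed
      qed
    qed (use IH in \<open>simp add: run_snoc P0_def P1_def\<close>)
  qed simp
qed

text \<open>Such a \<open>v\<close> was neither active nor ever the minimal candidate, so striking
  it from the candidate sets changes no choice.\<close>

lemma run_without_eq:
  assumes "v \<notin> Field (run E y evs)" "Deadline v \<notin> set evs"
  shows "run (without E v) y evs = run E y evs"
  using assms
proof (induction evs rule: rev_induct)
  case (snoc e evs)
  have sub: "Field (run E y evs) \<subseteq> Field (run E y (evs @ [e]))"
    using run_prefix_mono[of E y evs "[e]"] by (rule mono_Field)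
  with snoc have IH: "run (without E v) y evs = run E y evs" by auto
  show ?case
  proof (cases e)
    case (Deadline q)
    let ?P = "run E y evs"
    define z where "z = arg_min_on y (free_nbrs E ?P q)"
    have q: "q \<noteq> v" using snoc Deadline by auto
    have N0: "free_nbrs (without E v) ?P q = free_nbrs E ?P q - {v}"
      using q by (auto simp: free_nbrs_def without_def)
    show ?thesis
    proof (cases "q \<in> Field ?P \<or> free_nbrs E ?P q = {}")
      case False
      have z: "z \<in> free_nbrs E ?P q" "\<And>b. b \<in> free_nbrs E ?P q \<Longrightarrow> y z \<le> y b"
        using False choice_mem choice_le by (auto simp: z_def)
      have "(q, z) \<in> run E y (evs @ [e])" using False by (simp add: run_snoc Deadline z_def)
      then have "z \<noteq> v" using snoc.prems by (auto simp: Field_def)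
      interpret W: ranked_graph V "without E v" y by (rule without_ranked_graph)
      have "arg_min_on y (free_nbrs (without E v) ?P q) = z"
        using z \<open>z \<noteq> v\<close> by (intro W.choice_eqI) (auto simp: N0)
      moreover have "free_nbrs (without E v) ?P q \<noteq> {}" using z \<open>z \<noteq> v\<close> by (auto simp: N0)
      ultimately show ?thesis using False by (simp add: run_snoc IH Deadline z_def)
    next
      case True
      then show ?thesis by (auto simp: run_snoc IH Deadline N0)
    qed
  qed (simp add: run_snoc IH)
qed simp

end

section \<open>Sharing the value of a matched edge\<close>

definition share :: "real \<Rightarrow> real" where
  "share x = 39 / 100 + 48 / 100 * x"

lemma share_bounds: "0 \<le> x \<Longrightarrow> x \<le> 1 \<Longrightarrow> 39 / 100 \<le> share x \<and> share x \<le> 1"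
  by (auto simp: share_def)

lemma share_mono: "x \<le> x' \<Longrightarrow> share x \<le> share x'"
  by (simp add: share_def)

text \<open>Summing over all pairs, rather than selecting the pair of \<open>q\<close>, makes the
  total value an exchange of sums and lets a single nonnegative summand serve as a lower
  bound.\<close>

definition gain :: "('v \<Rightarrow> real) \<Rightarrow> ('v \<times> 'v) set \<Rightarrow> 'v \<Rightarrow> real" where
  "gain y P q =
     (\<Sum>(a, b)\<in>P. (if a = q then 1 - share (y b) else 0) + (if b = q then share (y b) else 0))"

lemma sum_gain:
  assumes "finite V" "P \<subseteq> V \<times> V"
  shows "(\<Sum>q\<in>V. gain y P q) = real (card P)"
proof -
  have "(\<Sum>q\<in>V. gain y P q) = (\<Sum>(a, b)\<in>P. \<Sum>q\<in>V.
      (if a = q then 1 - share (y b) else 0) + (if b = q then share (y b) else 0))"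
    unfolding gain_def by (subst sum.swap) (simp add: case_prod_unfold)
  also have "\<dots> = (\<Sum>(a, b)\<in>P. 1)"
    using assms by (intro sum.cong) (auto simp: sum.distrib)
  finally show ?thesis by (simp add: case_prod_unfold)
qed

section \<open>Lower bounds on the gains in a single run\<close>

locale unit_ranked_graph = ranked_graph +
  assumes unit: "\<And>a. a \<in> V \<Longrightarrow> 0 \<le> y a \<and> y a \<le> 1"
begin

lemma gain_summand_nonneg:
  "p \<in> run E y evs \<Longrightarrow> 0 \<le> (case p of (a, b) \<Rightarrow>
     (if a = q then 1 - share (y b) else 0) + (if b = q then share (y b) else 0))"
proof -
  assume "p \<in> run E y evs"
  then have "snd p \<in> V" using run_sub[of y evs] by auto
  then have "0 \<le> share (y (snd p)) \<and> share (y (snd p)) \<le> 1"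
    using share_bounds[of "y (snd p)"] unit[of "snd p"] by simp
  then show ?thesis by (auto split: prod.split)
qed

lemma gain_nonneg: "0 \<le> gain y (run E y evs) q"
  unfolding gain_def by (intro sum_nonneg gain_summand_nonneg)

lemma gain_ge:
  assumes "(a, b) \<in> run E y evs"
  shows "(if a = q then 1 - share (y b) else 0) + (if b = q then share (y b) else 0)
    \<le> gain y (run E y evs) q"
proof -
  let ?f = "\<lambda>(a, b). (if a = q then 1 - share (y b) else 0) + (if b = q then share (y b) else 0)"
  have "?f (a, b) \<le> sum ?f (run E y evs)"
    using assms gain_summand_nonneg by (intro member_le_sum finite_run) auto
  then show ?thesis by (simp add: gain_def)
qed

lemma gain_active:
  assumes "(q, b) \<in> run E y evs"
  shows "1 - share (y b) \<le> gain y (run E y evs) q"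
  using gain_ge[OF assms, of q] assms run_sub[of y evs] unit[of b] share_bounds[of "y b"]
  by (auto split: if_splits)

lemma gain_passive:
  assumes "(a, q) \<in> run E y evs"
  shows "share (y q) \<le> gain y (run E y evs) q"
  using gain_ge[OF assms, of q] assms run_sub[of y evs] unit[of q] share_bounds[of "y q"]
  by (auto split: if_splits)

text \<open>Active endpoints have passed their deadlines, so a vertex matched earlier is passive;
  its pair survives in every longer run.\<close>

lemma gain_before_deadline:
  assumes "q \<in> Field (run E y pre)" "Deadline q \<notin> set pre"
  shows "share (y q) \<le> gain y (run E y (pre @ post)) q"
proof -
  obtain a where "(a, q) \<in> run E y pre"
    using assms active_deadline by (fastforce simp: Field_def)
  then show ?thesis using run_prefix_mono by (intro gain_passive) fast
qed

lemma matched_at_deadline: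
  assumes "u \<notin> Field (run E y pre)" "z \<in> free_nbrs E (run E y pre) u"
  obtains r where "r \<in> free_nbrs E (run E y pre) u" "\<And>b. b \<in> free_nbrs E (run E y pre) u \<Longrightarrow> y r \<le> y b"
    "(u, r) \<in> run E y (pre @ Deadline u # post)"
proof
  let ?N = "free_nbrs E (run E y pre) u"
  have "(u, arg_min_on y ?N) \<in> run E y (pre @ [Deadline u])"
    using assms by (auto simp: run_snoc)
  then show "(u, arg_min_on y ?N) \<in> run E y (pre @ Deadline u # post)"
    using run_prefix_mono[of E y "pre @ [Deadline u]" post] by auto
  show "arg_min_on y ?N \<in> ?N" using assms choice_mem by blast
  show "y (arg_min_on y ?N) \<le> y b" if "b \<in> ?N" for b using that by (rule choice_le)
qed

text \<open>The run without \<open>v\<close> sorts the outcomes independently of the rank of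
  \<open>v\<close>. By \<open>run_without_mono\<close>, restoring \<open>v\<close> keeps
  \<open>u\<close> matched if it was, and keeps every member of \<open>Z\<close> free. If
  \<open>v\<close> itself is still free at the deadline of \<open>u\<close>, then by
  \<open>run_without_eq\<close> the two runs coincide up to that point.\<close>

lemma edge_gain:
  fixes pre post u v L
  assumes bip: "\<And>a b. {a, b} \<in> E \<Longrightarrow> a \<in> L \<longleftrightarrow> b \<notin> L" and v: "v \<notin> L" and e: "{u, v} \<in> E"
    and du: "Deadline u \<notin> set pre" and dv: "Deadline v \<notin> set pre"
  defines "evs \<equiv> pre @ Deadline u # post"
    and "P0 \<equiv> run (without E v) y pre"
  defines "Z \<equiv> free_nbrs (without E v) P0 u"
  defines "worth \<equiv> gain y (run E y evs) u + gain y (run E y evs) v"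
  shows "u \<in> Field P0 \<Longrightarrow> share (y u) \<le> worth"
    and "u \<notin> Field P0 \<Longrightarrow> Z = {} \<Longrightarrow> share (y v) \<le> worth"
    and "u \<notin> Field P0 \<Longrightarrow> z \<in> Z \<Longrightarrow> y v < y z \<Longrightarrow> (\<And>b. b \<in> Z \<Longrightarrow> y z \<le> y b) \<Longrightarrow>
      share (y v) + min (share (y u)) (1 - share (y z)) \<le> worth"
    and "u \<notin> Field P0 \<Longrightarrow> z \<in> Z \<Longrightarrow> y z < y v \<Longrightarrow>
      1 - share (y z) \<le> worth"
proof -
  let ?g = "gain y (run E y evs)"
  define P1 where "P1 = run E y pre"
  have uL: "u \<in> L" using bip[OF e] v by simp
  have uv: "u \<in> V" "v \<in> V" "u \<noteq> v" using edge_in_V[OF e] by auto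
  have mono: "Field P0 \<inter> L \<subseteq> Field P1" "Field P1 - L \<subseteq> insert v (Field P0)"
    using run_without_mono[OF bip v] by (auto simp: P0_def P1_def)
  have nonneg: "0 \<le> ?g u" "0 \<le> ?g v" by (auto intro: gain_nonneg)
  have u_passive: "share (y u) \<le> ?g u" if "u \<in> Field P1"
    using gain_before_deadline[OF that[unfolded P1_def] du] by (simp add: evs_def)
  have v_passive: "share (y v) \<le> ?g v" if "v \<in> Field P1"
    using gain_before_deadline[OF that[unfolded P1_def] dv] by (simp add: evs_def)
  have Z: "z \<in> V \<and> {u, z} \<in> E \<and> z \<notin> L \<and> z \<notin> Field P0 \<and> z \<noteq> v" if "z \<in> Z" for z
    using that edge_in_V[of u z] bip[of u z] uL
    by (auto simp: Z_def free_nbrs_def without_def)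
  have Z1: "z \<in> free_nbrs E P1 u" if "z \<in> Z" for z
    using Z[OF that] mono by (auto simp: free_nbrs_def)
  \<comment> \<open>The neighbour taken by \<open>u\<close> has rank at most \<open>y z\<close>, and
    the active share decreases in that rank.\<close>
  have matched: "1 - share (y z) \<le> ?g u" if uP: "u \<notin> Field P1" and z: "z \<in> Z" for z
  proof -
    obtain r where r: "y r \<le> y z" "(u, r) \<in> run E y evs"
      using matched_at_deadline[OF uP[unfolded P1_def] Z1[OF z, unfolded P1_def], of post] Z1[OF z]
      unfolding P1_def evs_def by blast
    then show ?thesis using gain_active[of u r evs] share_mono[of "y r" "y z"] by linarith
  qed
  have u_gain: "min (share (y u)) (1 - share (y z)) \<le> ?g u" if "z \<in> Z" for z
    using matched[OF _ that] u_passive by (cases "u \<in> Field P1") auto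
  have v_free: "P1 = P0" if "v \<notin> Field P1"
    using run_without_eq[of v pre] that dv by (simp add: P0_def P1_def)
  \<comment> \<open>Here \<open>v\<close> beats all other candidates, so \<open>u\<close> takes it
    and the edge itself contributes its full value 1.\<close>
  have v_chosen: "1 \<le> worth"
    if vP: "v \<notin> Field P1" and uP: "u \<notin> Field P0" and less: "\<And>b. b \<in> Z \<Longrightarrow> y v < y b"
  proof -
    have N: "free_nbrs E P1 u \<subseteq> insert v Z"
      using uv v_free[OF vP] by (auto simp: Z_def free_nbrs_def without_def)
    have vN: "v \<in> free_nbrs E P1 u" using vP e by (simp add: free_nbrs_def)
    have uP1: "u \<notin> Field P1" using v_free[OF vP] uP by simp
    obtain r where r: "r \<in> free_nbrs E P1 u" "y r \<le> y v" "(u, r) \<in> run E y evs"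
      using matched_at_deadline[OF uP1[unfolded P1_def] vN[unfolded P1_def], of post] vN
      unfolding P1_def evs_def by blast
    with N less[of r] have "r = v" by force
    then show ?thesis
      using gain_active[of u v evs] gain_passive[of u v evs] r by (simp add: worth_def)
  qed
  have sh: "39 / 100 \<le> share (y a)" "share (y a) \<le> 1" if "a \<in> V" for a
    using that unit share_bounds by auto
  show "share (y u) \<le> worth" if "u \<in> Field P0"
    using that uL mono u_passive nonneg by (auto simp: worth_def)
  show "share (y v) \<le> worth" if "u \<notin> Field P0" "Z = {}"
    using that v_chosen sh[OF uv(2)] v_passive nonneg by (cases "v \<in> Field P1") (auto simp: worth_def)
  show "share (y v) + min (share (y u)) (1 - share (y z)) \<le> worth"
    if "u \<notin> Field P0" "z \<in> Z" "y v < y z" "(\<And>b. b \<in> Z \<Longrightarrow> y z \<le> y b)"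
  proof (cases "v \<in> Field P1")
    case False
    have "1 \<le> worth" using that False by (intro v_chosen) force+
    then show ?thesis using share_mono[of "y v" "y z"] that by linarith
  qed (use u_gain[OF that(2)] v_passive in \<open>simp add: worth_def\<close>)
  show "1 - share (y z) \<le> worth" if "u \<notin> Field P0" "z \<in> Z" "y z < y v"
  proof (cases "v \<in> Field P1")
    case False
    then show ?thesis using that v_free matched[of z] nonneg by (simp add: worth_def)
  next
    case True
    \<comment> \<open>If the minimum in \<open>u_gain\<close> is \<open>share (y u)\<close>, then
      \<open>share (y u) + share (y v) + share (y z)\<close> is at least 3 * 0.39 > 1. Otherwise the
      gain of \<open>u\<close> alone suffices.\<close>
    have "share (y z) \<le> share (y v)" using that by (intro share_mono) simp
    then show ?thesis
      using True v_passive u_gain[OF that(2)] sh[OF uv(1)] sh[of z] Z[OF that(2)]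
      by (simp add: worth_def min_def split: if_splits)
  qed
qed

end

section \<open>Averaging over the ranks\<close>

abbreviation unit_uniform :: "real measure" where
  "unit_uniform \<equiv> uniform_measure lborel {0..<1}"

lemma prob_space_unit_uniform: "prob_space unit_uniform"
  by (intro prob_space_uniform_measure) auto

lemma AE_unit_uniform_range: "AE t in unit_uniform. 0 \<le> t \<and> t < 1"
  by (intro AE_uniform_measureI) auto

lemma AE_unit_uniform_finite:
  assumes "finite F"
  shows "AE t in unit_uniform. t \<notin> F"
proof (rule AE_uniform_measureI)
  have "AE t in lborel. t \<notin> F"
    using assms by (intro AE_not_in finite_imp_null_set_lborel)
  then show "AE t in lborel. t \<in> {0..<1} \<longrightarrow> t \<notin> F" by eventually_elim simp
qed simp

lemma nn_integral_unit_uniform: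
  fixes h :: "real \<Rightarrow> real"
  assumes [measurable]: "h \<in> borel_measurable borel"
    and nonneg: "\<And>t. 0 \<le> t \<Longrightarrow> t \<le> 1 \<Longrightarrow> 0 \<le> h t" and I: "(h has_integral I) {0..1}"
  shows "(\<integral>\<^sup>+t. ennreal (h t) \<partial>unit_uniform) = ennreal I"
proof -
  have "(\<integral>\<^sup>+t. ennreal (h t) \<partial>unit_uniform) = (\<integral>\<^sup>+t. ennreal (h t) * indicator {0..<1} t \<partial>lborel)"
    by (subst nn_integral_uniform_measure) (auto simp: divide_ennreal_def)
  also have "\<dots> = (\<integral>\<^sup>+t. ennreal (h t) * indicator {0..1} t \<partial>lborel)"
    using AE_lborel_singleton[of "1::real"]
    by (intro nn_integral_cong_AE, elim eventually_mono) (auto simp: indicator_def)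
  also have "\<dots> = ennreal I"
    using nonneg I by (intro nn_integral_has_integral_lebesgue') auto
  finally show ?thesis .
qed

section \<open>Independent ranks: almost surely distinct and in range\<close>

lemma measurable_rank:
  assumes "a \<in> W"
  shows "(\<lambda>x. x a) \<in> borel_measurable (Pi\<^sub>M W (\<lambda>_. unit_uniform))"
  using measurable_component_singleton[OF assms, of "\<lambda>_. unit_uniform"]
  by (subst (asm) measurable_cong_sets[OF refl, of _ borel]) simp_all

lemma AE_PiM_inj:
  assumes W: "finite W"
  shows "AE x in Pi\<^sub>M W (\<lambda>_. unit_uniform). inj_on x W"
proof -
  interpret U: prob_space unit_uniform by (rule prob_space_unit_uniform)
  interpret P: product_sigma_finite "\<lambda>_. unit_uniform" by standard
  have "AE x in Pi\<^sub>M W (\<lambda>_. unit_uniform). x a \<noteq> x b" if ab: "a \<in> W" "b \<in> W" "a \<noteq> b" for a b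
  proof -
    let ?M = "Pi\<^sub>M W (\<lambda>_. unit_uniform)" and ?J = "W - {a}"
    have W': "insert a ?J = W" using ab by auto
    note [measurable] = measurable_rank[OF ab(1)] measurable_rank[OF ab(2)]
    have S: "{x \<in> space ?M. x a = x b} \<in> sets ?M" by measurable
    have f: "indicator {x \<in> space ?M. x a = x b} \<in> borel_measurable (Pi\<^sub>M (insert a ?J) (\<lambda>_. unit_uniform))"
      unfolding W' using S by simp
    have "emeasure ?M {x \<in> space ?M. x a = x b} =
      (\<integral>\<^sup>+x. indicator {x \<in> space ?M. x a = x b} x \<partial>Pi\<^sub>M (insert a ?J) (\<lambda>_. unit_uniform))"
      unfolding W' using S by simp
    also have "\<dots> = (\<integral>\<^sup>+x. \<integral>\<^sup>+t. indicator {x \<in> space ?M. x a = x b} (x(a := t)) \<partial>unit_uniform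
        \<partial>Pi\<^sub>M ?J (\<lambda>_. unit_uniform))"
      using W by (intro P.product_nn_integral_insert f) auto
    also have "\<dots> = (\<integral>\<^sup>+x. 0 \<partial>Pi\<^sub>M ?J (\<lambda>_. unit_uniform))"
    \<comment> \<open>With all other coordinates fixed, a tie needs \<open>t\<close> to be the
      single point \<open>x b\<close>, which is null.\<close>
    proof (intro nn_integral_cong)
      fix x
      have "(\<integral>\<^sup>+t. indicator {x \<in> space ?M. x a = x b} (x(a := t)) \<partial>unit_uniform) \<le>
          (\<integral>\<^sup>+t. 0 \<partial>unit_uniform)"
      proof (rule nn_integral_mono_AE)
        have "AE t in unit_uniform. t \<notin> {x b}" by (rule AE_unit_uniform_finite) simp
        then show "AE t in unit_uniform. indicator {x \<in> space ?M. x a = x b} (x(a := t)) \<le> (0 :: ennreal)"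
          by eventually_elim (use ab(3) in \<open>auto simp: indicator_def\<close>)
      qed
      then show "(\<integral>\<^sup>+t. indicator {x \<in> space ?M. x a = x b} (x(a := t)) \<partial>unit_uniform) = 0" by simp
    qed
    finally have "emeasure ?M {x \<in> space ?M. x a = x b} = 0" by simp
    with S show ?thesis by (intro AE_I'[of "{x \<in> space ?M. x a = x b}"]) auto
  qed
  then have "AE x in Pi\<^sub>M W (\<lambda>_. unit_uniform). \<forall>a\<in>W. \<forall>b\<in>W. a \<noteq> b \<longrightarrow> x a \<noteq> x b"
    using W by (intro AE_finite_allI) auto
  then show ?thesis by eventually_elim (auto simp: inj_on_def)
qed

lemma AE_PiM_range:
  assumes "finite W"
  shows "AE x in Pi\<^sub>M W (\<lambda>_. unit_uniform). \<forall>a\<in>W. 0 \<le> x a \<and> x a < 1"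
  using assms prob_space_unit_uniform AE_unit_uniform_range
  by (intro AE_finite_allI AE_PiM_component) auto

section \<open>Integrals of the bounding functions\<close>

lemma share_has_integral:
  "a \<le> b \<Longrightarrow> (share has_integral ((39/100 * b + 24/100 * b\<^sup>2) - (39/100 * a + 24/100 * a\<^sup>2))) {a..b}"
  unfolding share_def
  by (rule fundamental_theorem_of_calculus)
    (auto intro!: derivative_eq_intros simp flip: has_real_derivative_iff_has_vector_derivative)

lemma share_measurable [measurable]: "share \<in> borel_measurable borel"
  unfolding share_def by measurable

text \<open>The point 211/480 solves \<open>share t = 601/1000\<close>. The subtracted term is the
  area of the triangle between the cap and the line of slope 0.48.\<close>

lemma min_share_has_integral:
  "((\<lambda>t. min (share t) (601/1000)) has_integral (601/1000 - 24/100 * (211/480)\<^sup>2)) {0..1}"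
proof -
  have 1: "((\<lambda>t. min (share t) (601/1000)) has_integral (39/100 * (211/480) + 24/100 * (211/480)\<^sup>2)) {0..211/480}"
    by (rule has_integral_eq[rotated], use share_has_integral[of 0 "211/480"] in simp) (auto simp: share_def)
  have 2: "((\<lambda>t. min (share t) (601/1000)) has_integral (601/1000 * (1 - 211/480))) {211/480..1}"
    by (rule has_integral_eq[rotated], use has_integral_const_real[of "601/1000::real" "211/480" 1] in simp)
      (auto simp: share_def)
  show ?thesis using has_integral_combine[OF _ _ 1 2] by (simp add: power2_eq_square)
qed

lemma threshold_has_integral:
  assumes "0 \<le> s" "s \<le> 1"
  shows "((\<lambda>t. if t < s then share t + m else d) has_integral
    (39/100 * s + 24/100 * s\<^sup>2 + s * m + (1 - s) * d)) {0..1}"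
proof -
  have 1: "((\<lambda>t. if t < s then share t + m else d) has_integral (39/100 * s + 24/100 * s\<^sup>2 + s * m)) {0..s}"
  \<comment> \<open>At \<open>t = s\<close> the function already takes the value \<open>d\<close>; a
    single point does not affect the integral.\<close>
  proof (rule has_integral_spike_finite[of "{s}"])
    show "((\<lambda>t. share t + m) has_integral (39/100 * s + 24/100 * s\<^sup>2 + s * m)) {0..s}"
      using has_integral_add[OF share_has_integral[OF assms(1)] has_integral_const_real[of m 0 s]] assms
      by simp
  qed auto
  have 2: "((\<lambda>t. if t < s then share t + m else d) has_integral ((1 - s) * d)) {s..1}"
    by (rule has_integral_eq[rotated], use has_integral_const_real[of d s 1] assms in simp) auto
  show ?thesis using has_integral_combine[OF _ _ 1 2] assms by simp
qed

section \<open>Gains as random variables\<close>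

context graph
begin

text \<open>The run factors through the strict order \<open>rel y\<close> of the ranks on
  \<open>V\<close>, one of finitely many relations. For each fixed relation the gain is a finite sum
  of measurable functions of single ranks.\<close>

lemma gain_measurable:
  "(\<lambda>y. gain y (run E y evs) q) \<in> borel_measurable (Pi\<^sub>M V (\<lambda>_. unit_uniform))"
proof -
  let ?M = "Pi\<^sub>M V (\<lambda>_. unit_uniform)"
  define rel where "rel y = {(a, b) \<in> V \<times> V. (y a :: real) < y b}" for y
  have rel_iff: "(a, b) \<in> rel y \<longleftrightarrow> a \<in> V \<and> b \<in> V \<and> y a < y b" for a b y
    by (simp add: rel_def)
  \<comment> \<open>A representative ranking is chosen for each relation. If \<open>R\<close> is not
    the order of any ranking, \<open>H R\<close> is still some run, hence a set of pairs over
    \<open>V\<close>, which is all that measurability needs.\<close>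
  define H where "H R = run E (SOME y. rel y = R) evs" for R
  have H: "H (rel y) = run E y evs" for y
  proof -
    have "rel (SOME y'. rel y' = rel y) = rel y" by (rule someI[of "\<lambda>y'. rel y' = rel y" y]) simp
    moreover have "\<Union>E \<subseteq> V" using E_sub by auto
    ultimately show ?thesis
      unfolding H_def by (intro run_cong) (auto simp: rel_def set_eq_iff)
  qed
  have preimage: "rel -` {R} \<inter> space ?M \<in> sets ?M" if R: "R \<in> Pow (V \<times> V)" for R
  proof -
    have "{y \<in> space ?M. y a < y b \<longleftrightarrow> (a, b) \<in> R} \<in> sets ?M" if ab: "a \<in> V" "b \<in> V" for a b
    proof -
      note [measurable] = ab[THEN measurable_rank]
      show ?thesis by measurable
    qed
    then have "{y \<in> space ?M. \<forall>b\<in>V. y a < y b \<longleftrightarrow> (a, b) \<in> R} \<in> sets ?M" if "a \<in> V" for a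
      using that finite_V by (intro sets.sets_Collect_finite_All) auto
    then have "{y \<in> space ?M. \<forall>a\<in>V. \<forall>b\<in>V. y a < y b \<longleftrightarrow> (a, b) \<in> R} \<in> sets ?M"
      using finite_V by (intro sets.sets_Collect_finite_All) auto
    moreover have "rel y = R \<longleftrightarrow> (\<forall>a\<in>V. \<forall>b\<in>V. y a < y b \<longleftrightarrow> (a, b) \<in> R)" for y
      using R rel_iff[of _ _ y] by (subst set_eq_iff) auto
    then have "rel -` {R} \<inter> space ?M =
        {y \<in> space ?M. \<forall>a\<in>V. \<forall>b\<in>V. y a < y b \<longleftrightarrow> (a, b) \<in> R}"
      by auto
    ultimately show ?thesis by simp
  qed
  have fin: "finite (Pow (V \<times> V))" using finite_V by simp
  have rel: "rel \<in> measurable ?M (count_space (Pow (V \<times> V)))"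
    unfolding measurable_count_space_eq2[OF fin] using preimage by (auto simp: rel_def)
  have "(\<lambda>y. gain y (H (rel y)) q) \<in> borel_measurable ?M"
  proof (rule measurable_compose_countable'[where I = "Pow (V \<times> V)" and f = "\<lambda>R y. gain y (H R) q" and g = rel])
    show "countable (Pow (V \<times> V))" using finite_V by (intro countable_finite) simp
    show "(\<lambda>y. gain y (H R) q) \<in> borel_measurable ?M" for R
      unfolding gain_def
    proof (intro borel_measurable_sum)
      fix p assume "p \<in> H R"
      then have "snd p \<in> V" using run_sub by (fastforce simp: H_def)
      note [measurable] = measurable_rank[OF this]
      show "(\<lambda>y. case p of (a, b) \<Rightarrow> (if a = q then 1 - share (y b) else 0) +
          (if b = q then share (y b) else 0)) \<in> borel_measurable ?M"
        unfolding case_prod_unfold by measurable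
    qed
    show "rel \<in> measurable ?M (count_space (Pow (V \<times> V)))" by (rule rel)
  qed
  then show ?thesis by (simp add: H)
qed

lemma AE_unit_ranked: "AE y in Pi\<^sub>M V (\<lambda>_. unit_uniform). unit_ranked_graph V E y"
  using AE_PiM_inj[OF finite_V] AE_PiM_range[OF finite_V]
  by eventually_elim (unfold_locales, auto)

lemma gain_integrable: "integrable (Pi\<^sub>M V (\<lambda>_. unit_uniform)) (\<lambda>y. gain y (run E y evs) q)"
proof -
  interpret P: prob_space "Pi\<^sub>M V (\<lambda>_. unit_uniform)"
    by (intro prob_space_PiM prob_space_unit_uniform)
  have "AE y in Pi\<^sub>M V (\<lambda>_. unit_uniform). norm (gain y (run E y evs) q) \<le> real (card (insert q V \<times> insert q V))"
    using AE_unit_ranked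
  proof eventually_elim
    case (elim y)
    interpret unit_ranked_graph V E y by fact
    \<comment> \<open>The gain is at most the total value of the run. Summing over
      \<open>insert q V\<close> also covers a \<open>q\<close> outside \<open>V\<close>.\<close>
    have "gain y (run E y evs) q \<le> (\<Sum>q\<in>insert q V. gain y (run E y evs) q)"
      using finite_V gain_nonneg by (intro member_le_sum) auto
    also have "\<dots> = real (card (run E y evs))"
      using finite_V run_sub by (intro sum_gain) auto
    also have "\<dots> \<le> real (card (insert q V \<times> insert q V))"
      using finite_V run_sub by (intro of_nat_mono card_mono) auto
    finally show ?case using gain_nonneg by simp
  qed
  then show ?thesis by (intro P.integrable_const_bound gain_measurable)
qed

text \<open>With the other ranks fixed, \<open>P0\<close> and \<open>Z\<close> are constant in
  \<open>t\<close>, so exactly one configuration of \<open>edge_gain\<close> applies for almost all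
  \<open>t\<close> apart from the comparison of \<open>t\<close> with the least rank in
  \<open>Z\<close>. Integrating its bound over \<open>t\<close> leaves a quantity that depends on
  \<open>x u\<close> only.\<close>

lemma conditional_edge_gain:
  fixes pre post :: "'v event list"
  assumes bip: "\<And>a b. {a, b} \<in> E \<Longrightarrow> a \<in> L \<longleftrightarrow> b \<notin> L" and v: "v \<notin> L" and e: "{u, v} \<in> E"
    and du: "Deadline u \<notin> set pre" and dv: "Deadline v \<notin> set pre"
    and inj: "inj_on x (V - {v})" and range: "\<And>a. a \<in> V - {v} \<Longrightarrow> 0 \<le> x a \<and> x a < 1"
  defines "evs \<equiv> pre @ Deadline u # post"
  defines "worth \<equiv> \<lambda>y. gain y (run E y evs) u + gain y (run E y evs) v"
  shows "ennreal (min (share (x u)) (601/1000)) \<le> (\<integral>\<^sup>+t. ennreal (worth (x(v := t))) \<partial>unit_uniform)"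
proof -
  have uv: "u \<in> V" "v \<in> V" "u \<noteq> v" using edge_in_V[OF e] by auto
  define P0 where "P0 = run (without E v) x pre"
  define Z where "Z = free_nbrs (without E v) P0 u"
  have ZV: "Z \<subseteq> V - {v}"
    using edge_in_V by (auto simp: Z_def free_nbrs_def without_def)
  then have finZ: "finite Z" using finite_V by (meson finite_Diff finite_subset)
  have P0: "run (without E v) (x(v := t)) pre = P0" for t
    unfolding P0_def by (intro run_cong) (auto simp: without_def)
  have good: "AE t in unit_uniform. unit_ranked_graph V E (x(v := t)) \<and> t \<notin> x ` (V - {v})"
    using AE_unit_uniform_range
      AE_unit_uniform_finite[OF finite_imageI[OF finite_Diff[OF finite_V]], of x "{v}"]
  proof eventually_elim
    case (elim t)
    have "inj_on (x(v := t)) (insert v (V - {v}))"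
      using inj elim by (subst inj_on_insert) (auto simp: inj_on_def)
    then have "inj_on (x(v := t)) V" using uv by (simp add: insert_absorb)
    then have "unit_ranked_graph V E (x(v := t))"
      using elim(1) range by unfold_locales (auto simp: less_imp_le)
    with elim(2) show ?case by simp
  qed
  \<comment> \<open>Any pointwise lower bound \<open>h\<close> may fail where \<open>t\<close> ties
    with another rank, which is a null event.\<close>
  have bound: "ennreal I \<le> (\<integral>\<^sup>+t. ennreal (worth (x(v := t))) \<partial>unit_uniform)"
    if h: "h \<in> borel_measurable borel" "(h has_integral I) {0..1}" "\<And>t. 0 \<le> t \<Longrightarrow> t \<le> 1 \<Longrightarrow> 0 \<le> h t"
      and le: "\<And>t. unit_ranked_graph V E (x(v := t)) \<Longrightarrow> t \<notin> x ` (V - {v}) \<Longrightarrow> h t \<le> worth (x(v := t))"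
    for h I
  proof -
    have "ennreal I = (\<integral>\<^sup>+t. ennreal (h t) \<partial>unit_uniform)"
      using h by (intro nn_integral_unit_uniform[symmetric])
    also have "\<dots> \<le> (\<integral>\<^sup>+t. ennreal (worth (x(v := t))) \<partial>unit_uniform)"
      using good by (intro nn_integral_mono_AE, elim eventually_mono) (auto intro!: ennreal_leI le)
    finally show ?thesis .
  qed
  have edge: "u \<in> Field P0 \<Longrightarrow> share (x u) \<le> worth (x(v := t))"
    "u \<notin> Field P0 \<Longrightarrow> Z = {} \<Longrightarrow> share t \<le> worth (x(v := t))"
    "u \<notin> Field P0 \<Longrightarrow> z \<in> Z \<Longrightarrow> t < x z \<Longrightarrow> (\<And>b. b \<in> Z \<Longrightarrow> x z \<le> x b) \<Longrightarrow>
      share t + min (share (x u)) (1 - share (x z)) \<le> worth (x(v := t))"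
    "u \<notin> Field P0 \<Longrightarrow> z \<in> Z \<Longrightarrow> x z < t \<Longrightarrow> 1 - share (x z) \<le> worth (x(v := t))"
    if t: "unit_ranked_graph V E (x(v := t))" for t z
  proof -
    interpret T: unit_ranked_graph V E "x(v := t)" by (rule t)
    note edge = T.edge_gain[OF bip v e du dv, where post = post, unfolded P0, folded Z_def evs_def]
    have w: "worth (x(v := t)) = gain (x(v := t)) (run E (x(v := t)) evs) u + gain (x(v := t)) (run E (x(v := t)) evs) v"
      by (simp only: worth_def)
    have other: "(x(v := t)) b = x b" if "b \<in> Z" for b using that ZV by auto
    show "u \<in> Field P0 \<Longrightarrow> share (x u) \<le> worth (x(v := t))"
      using edge(1) uv unfolding w by simp
    show "u \<notin> Field P0 \<Longrightarrow> Z = {} \<Longrightarrow> share t \<le> worth (x(v := t))"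
      using edge(2) unfolding w by simp
    show "share t + min (share (x u)) (1 - share (x z)) \<le> worth (x(v := t))"
      if "u \<notin> Field P0" "z \<in> Z" "t < x z" "\<And>b. b \<in> Z \<Longrightarrow> x z \<le> x b"
      using edge(3)[of z] that other uv unfolding w by simp
    show "1 - share (x z) \<le> worth (x(v := t))" if "u \<notin> Field P0" "z \<in> Z" "x z < t"
      using edge(4)[of z] that other unfolding w by simp
  qed
  have xu: "39/100 \<le> share (x u)" "share (x u) \<le> 1"
    using range[of u] uv share_bounds[of "x u"] by auto
  consider "u \<in> Field P0" | "u \<notin> Field P0" "Z = {}" | "u \<notin> Field P0" "Z \<noteq> {}" by blast
  then show ?thesis
  proof cases
    case 1
    have "ennreal (share (x u)) \<le> (\<integral>\<^sup>+t. ennreal (worth (x(v := t))) \<partial>unit_uniform)"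
      by (rule bound[of "\<lambda>_. share (x u)"])
        (use 1 edge(1) uv xu has_integral_const_real[of "share (x u)" 0 1] in auto)
    then show ?thesis by (rule order_trans[rotated]) (auto intro!: ennreal_leI)
  next
    case 2
    \<comment> \<open>The mean of \<open>share\<close> over the unit interval is 0.39 + 0.24 = 0.63,
      above the cap 0.601.\<close>
    have "ennreal (63/100) \<le> (\<integral>\<^sup>+t. ennreal (worth (x(v := t))) \<partial>unit_uniform)"
    proof (rule bound[of share])
      show "(share has_integral 63/100) {0..1}" using share_has_integral[of 0 1] by simp
      show "share t \<le> worth (x(v := t))" if "unit_ranked_graph V E (x(v := t))" for t
        using edge(2)[OF that] 2 by simp
    qed (use share_bounds in force)+
    then show ?thesis by (rule order_trans[rotated]) (auto intro!: ennreal_leI)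
  next
    case 3
    define z where "z = arg_min_on x Z"
    define s where "s = x z"
    define m where "m = min (share (x u)) (1 - share s)"
    have z: "z \<in> Z" "\<And>b. b \<in> Z \<Longrightarrow> x z \<le> x b"
      using 3 finZ arg_min_on_mem arg_min_least[of Z _ x] by (auto simp: z_def)
    have zv: "z \<noteq> v" "z \<in> V" using z ZV by auto
    have s: "0 \<le> s" "s \<le> 1" using range[of z] zv by (auto simp: s_def)
    have m: "0 \<le> m" using xu s share_bounds[of s] by (auto simp: m_def)
    have "ennreal (39/100 * s + 24/100 * s\<^sup>2 + s * m + (1 - s) * (1 - share s)) \<le>
        (\<integral>\<^sup>+t. ennreal (worth (x(v := t))) \<partial>unit_uniform)"
    proof (rule bound[OF _ threshold_has_integral[OF s]])
      show "0 \<le> (if t < s then share t + m else 1 - share s)" if "0 \<le> t" "t \<le> 1" for t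
        using m s share_bounds[of t] share_bounds[of s] that by auto
      show "(if t < s then share t + m else 1 - share s) \<le> worth (x(v := t))"
        if t: "unit_ranked_graph V E (x(v := t))" "t \<notin> x ` (V - {v})" for t
      proof -
        have "t \<noteq> s" using t(2) zv by (auto simp: s_def)
        then show ?thesis
          using edge(3)[OF t(1) 3(1) z(1) _ z(2)] edge(4)[OF t(1) 3(1) z(1)]
          by (auto simp: s_def m_def)
      qed
    qed measurable
    \<comment> \<open>If \<open>m = share (x u)\<close>, the right side minus
      \<open>share (x u)\<close> is a sum of nonnegative terms. If \<open>m = 1 - share s\<close>,
      it is the quadratic 0.61 - 0.09 s + 0.24 s^2 with minimum 0.6015625 at s = 3/16; the cap 0.601
      lies just below this.\<close>
    moreover have "min (share (x u)) (601/1000) \<le> 39/100 * s + 24/100 * s\<^sup>2 + s * m + (1 - s) * (1 - share s)"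
    proof (cases "share (x u) \<le> 1 - share s")
      case True
      then have "0 \<le> (1 - s) * (1 - share s - share (x u))" using s by simp
      moreover have "0 \<le> 39/100 * s + 24/100 * s\<^sup>2" using s by simp
      ultimately show ?thesis using True by (simp add: m_def algebra_simps)
    next
      case False
      then have "39/100 * s + 24/100 * s\<^sup>2 + s * m + (1 - s) * (1 - share s) =
          601/1000 + 9/16000 + 24/100 * (s - 3/16)\<^sup>2"
        by (simp add: m_def share_def field_simps power2_eq_square)
      moreover have "0 \<le> (s - 3/16)\<^sup>2" by simp
      ultimately show ?thesis by linarith
    qed
    ultimately show ?thesis by (meson ennreal_leI order_trans)
  qed
qed

text \<open>By Fubini the rank of \<open>v\<close> is integrated first, using the conditional bound;
  what remains involves only \<open>y u\<close>, whose marginal is uniform.\<close>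

lemma expected_edge_gain:
  assumes bip: "\<And>a b. {a, b} \<in> E \<Longrightarrow> a \<in> L \<longleftrightarrow> b \<notin> L" and v: "v \<notin> L" and e: "{u, v} \<in> E"
    and du: "Deadline u \<notin> set pre" and dv: "Deadline v \<notin> set pre"
    and evs: "evs = pre @ Deadline u # post"
  defines "M \<equiv> Pi\<^sub>M V (\<lambda>_. unit_uniform)"
  shows "0.5541 \<le> (\<integral>y. gain y (run E y evs) u \<partial>M) + (\<integral>y. gain y (run E y evs) v \<partial>M)"
proof -
  interpret U: prob_space unit_uniform by (rule prob_space_unit_uniform)
  interpret P: product_sigma_finite "\<lambda>_. unit_uniform" by standard
  let ?w = "\<lambda>y. gain y (run E y evs) u + gain y (run E y evs) v"
  let ?J = "V - {v}"
  let ?N = "Pi\<^sub>M ?J (\<lambda>_. unit_uniform)"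
  have uv: "u \<in> V" "v \<in> V" "u \<noteq> v" using edge_in_V[OF e] by auto
  have VJ: "insert v ?J = V" using uv by auto
  have int: "integrable M ?w" unfolding M_def by (intro Bochner_Integration.integrable_add gain_integrable)
  \<comment> \<open>The right side is about 0.5546.\<close>
  have "ennreal 0.5541 \<le> ennreal (601/1000 - 24/100 * (211/480)\<^sup>2)"
    by (intro ennreal_leI) (simp add: power2_eq_square)
  also have "\<dots> = (\<integral>\<^sup>+t. ennreal (min (share t) (601/1000)) \<partial>unit_uniform)"
    using share_bounds by (intro nn_integral_unit_uniform[symmetric] min_share_has_integral) force+
  also have "\<dots> = (\<integral>\<^sup>+t. ennreal (min (share t) (601/1000)) \<partial>distr ?N unit_uniform (\<lambda>x. x u))"
    using uv by (subst distr_PiM_component) (auto intro: prob_space_unit_uniform)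
  also have "\<dots> = (\<integral>\<^sup>+x. ennreal (min (share (x u)) (601/1000)) \<partial>?N)"
    using uv by (intro nn_integral_distr measurable_component_singleton) auto
  also have "\<dots> \<le> (\<integral>\<^sup>+x. \<integral>\<^sup>+t. ennreal (?w (x(v := t))) \<partial>unit_uniform \<partial>?N)"
  proof (rule nn_integral_mono_AE)
    have fin: "finite ?J" using finite_V by simp
    show "AE x in ?N. ennreal (min (share (x u)) (601/1000)) \<le> (\<integral>\<^sup>+t. ennreal (?w (x(v := t))) \<partial>unit_uniform)"
      using AE_PiM_inj[OF fin] AE_PiM_range[OF fin]
    proof eventually_elim
      case (elim x)
      then show ?case unfolding evs by (intro conditional_edge_gain[OF bip v e du dv]) auto
    qed
  qed
  also have "\<dots> = (\<integral>\<^sup>+y. ennreal (?w y) \<partial>Pi\<^sub>M (insert v ?J) (\<lambda>_. unit_uniform))"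
  proof (rule P.product_nn_integral_insert[symmetric])
    show "(\<lambda>y. ennreal (?w y)) \<in> borel_measurable (Pi\<^sub>M (insert v ?J) (\<lambda>_. unit_uniform))"
      using int unfolding VJ M_def by simp
  qed (use finite_V in auto)
  also have "\<dots> = (\<integral>\<^sup>+y. ennreal (?w y) \<partial>M)" by (simp only: VJ M_def)
  also have "\<dots> = ennreal (\<integral>y. ?w y \<partial>M)"
  proof (rule nn_integral_eq_integral[OF int])
    show "AE y in M. 0 \<le> ?w y"
      using AE_unit_ranked unfolding M_def
      by eventually_elim (intro add_nonneg_nonneg unit_ranked_graph.gain_nonneg)
  qed
  finally have "0.5541 \<le> (\<integral>y. ?w y \<partial>M)"
    by (subst (asm) ennreal_le_iff2) auto
  then show ?thesis
    by (simp add: M_def gain_integrable)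
qed

end

section \<open>From single edges to a maximum matching\<close>

lemma deadline_order:
  assumes "Deadline u \<in> set evs" "Deadline v \<in> set evs" "u \<noteq> v"
  obtains a b pre post where "{a, b} = {u, v}" "evs = pre @ Deadline a # post"
    "Deadline a \<notin> set pre" "Deadline b \<notin> set pre"
proof -
  \<comment> \<open>Splitting at the first of the two deadlines decides which endpoint takes the
    role of \<open>u\<close>; neither deadline occurs in the prefix.\<close>
  have "\<exists>e\<in>set evs. e \<in> {Deadline u, Deadline v}" using assms by auto
  then obtain pre e post where *: "evs = pre @ e # post" "e \<in> {Deadline u, Deadline v}"
      "\<forall>e'\<in>set pre. e' \<notin> {Deadline u, Deadline v}"
    by (rule split_list_first_propE)
  then show thesis using that[of u v pre post] that[of v u pre post] by auto
qed

lemma bipartite_side: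
  assumes "bipartite V E"
  obtains L where "\<And>a b. {a, b} \<in> E \<Longrightarrow> a \<in> L \<longleftrightarrow> b \<notin> L"
proof -
  obtain A B where AB: "A \<inter> B = {}" "\<forall>e\<in>E. \<exists>a\<in>A. \<exists>b\<in>B. e = {a, b}"
    using assms by (auto simp: bipartite_def)
  have "a \<in> A \<longleftrightarrow> b \<notin> A" if "{a, b} \<in> E" for a b
    using AB that by (metis disjoint_iff doubleton_eq_iff)
  then show thesis using that by blast
qed

theorem theorem2:
  fixes V :: "'v set" and E :: "'v set set" and evs :: "'v event list"
  assumes "fully_online_instance V E evs"
    and "bipartite V E"
  shows "expected_ranking_size V E evs \<ge> 0.5541 * real (max_matching_size E)"
proof -
  interpret graph V E using assms(1) by unfold_locales (simp add: fully_online_instance_def)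
  define M where "M = Pi\<^sub>M V (\<lambda>_. unit_uniform)"
  define G where "G q = (\<integral>y. gain y (run E y evs) q \<partial>M)" for q
  have deadlines: "Deadline q \<in> set evs" if "q \<in> V" for q
    using assms(1) that by (auto simp: fully_online_instance_def)
  obtain L where L: "\<And>a b. {a, b} \<in> E \<Longrightarrow> a \<in> L \<longleftrightarrow> b \<notin> L"
    using bipartite_side[OF assms(2)] by blast
  have edge: "0.5541 \<le> (\<Sum>q\<in>e. G q)" if eE: "e \<in> E" for e
  proof -
    obtain u v where "e = {u, v}" "u \<noteq> v" using E_sub[OF eE] by (auto simp: card_2_iff)
    moreover from this have "u \<in> V" "v \<in> V" using E_sub[OF eE] by auto
    ultimately obtain a b pre post where ab: "e = {a, b}" "a \<noteq> b" "evs = pre @ Deadline a # post"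
      "Deadline a \<notin> set pre" "Deadline b \<notin> set pre"
      using deadline_order[of u evs v] deadlines by (metis doubleton_eq_iff)
    have "0.5541 \<le> G a + G b"
    \<comment> \<open>The edge bound wants the endpoint with the later deadline outside the chosen
      side; if it is in \<open>L\<close>, the complement serves as the side instead.\<close>
    proof (cases "b \<in> L")
      case False
      then show ?thesis
        unfolding G_def M_def using ab eE L by (intro expected_edge_gain[of L]) auto
    next
      case True
      have "b' \<in> - L \<longleftrightarrow> c \<notin> - L" if "{b', c} \<in> E" for b' c using L[OF that] by auto
      with True show ?thesis
        unfolding G_def M_def using ab eE by (intro expected_edge_gain[of "- L"]) auto
    qed
    with ab show ?thesis by simp
  qed
  have G_nonneg: "0 \<le> G q" for q
    unfolding G_def M_def using AE_unit_ranked
    by (intro integral_nonneg_AE, elim eventually_mono) (rule unit_ranked_graph.gain_nonneg)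
  have finE: "finite E" using E_sub finite_V by (meson Pow_iff finite_Pow_iff finite_subset subsetI)
  \<comment> \<open>Finiteness and the empty matching ensure that \<open>Max\<close> is attained, by
    some matching \<open>K\<close>.\<close>
  have "finite {card M |M. is_matching E M}"
    by (rule finite_subset[of _ "card ` Pow E"]) (use finE in \<open>auto simp: is_matching_def\<close>)
  moreover have "is_matching E {}" by (simp add: is_matching_def)
  ultimately have "max_matching_size E \<in> {card M |M. is_matching E M}"
    unfolding max_matching_size_def by (intro Max_in) auto
  then obtain K where K: "is_matching E K" "card K = max_matching_size E" by auto
  then have KE: "K \<subseteq> E" "disjoint K" by (auto simp: is_matching_def)
  then have KV: "\<Union>K \<subseteq> V" "\<And>e. e \<in> K \<Longrightarrow> finite e"
    using E_sub finite_V by (auto intro: finite_subset)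
  have "0.5541 * real (max_matching_size E) = (\<Sum>e\<in>K. 0.5541)" by (simp add: K)
  \<comment> \<open>Each edge of \<open>K\<close> collects 0.5541 from its endpoints. Disjointness
    prevents double counting, and vertices missed by \<open>K\<close> add nonnegative
    amounts.\<close>
  also have "\<dots> \<le> (\<Sum>e\<in>K. \<Sum>q\<in>e. G q)" using KE edge by (intro sum_mono) auto
  also have "\<dots> = (\<Sum>q\<in>\<Union>K. G q)"
    using KE KV by (intro sum.Union_disjoint[symmetric, simplified comp_def]) (auto simp: disjoint_def)
  also have "\<dots> \<le> (\<Sum>q\<in>V. G q)" using KV finite_V G_nonneg by (intro sum_mono2) auto
  also have "\<dots> = (\<integral>y. (\<Sum>q\<in>V. gain y (run E y evs) q) \<partial>M)"
    unfolding G_def M_def by (intro Bochner_Integration.integral_sum[symmetric] gain_integrable)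
  also have "\<dots> = expected_ranking_size V E evs"
    unfolding expected_ranking_size_def rank_measure_def M_def ranking_eq_edges_of_run
      card_edges_of_run
    by (simp add: sum_gain[OF finite_V run_sub])
  finally show ?thesis .
qed

end
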